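(* Let $(K,d)$ be a compact geodesic space satisfying the betweenness property. Then, in the lion-and-man game on $(K,d)$, Lion has a winning non-anticipative discrete-time strategy. That is, for every $\varepsilon>0$ there is a non-anticipative discrete-time strategy of Lion such that, for all initial positions $x^0,y^0\in K$ of Lion and Man and every admissible trajectory $M$ of Man with $M(0)=y^0$, the trajectory $L$ of Lion generated by the strategy satisfies $d\bigl(L(t),M(t)\bigr)<\varepsilon$ for some $t\in[0,+\infty)$.
   Context: Let $(K,d)$ be a metric space. A geodesic path joining $A\in K$ to $B\in K$ is a map $\gamma\colon[a,b]\subset\mathbb{R}\to K$ with $\gamma(a)=A$, $\gamma(b)=B$ and $d(\gamma(t),\gamma(t'))=|t-t'|$ for all $t,t'\in[a,b]$. $(K,d)$ is a geodesic space if every pair of points of $K$ can be joined by a geodesic path (not necessarily unique). A point $C$ lies between $A$ and $B$ if $d(A,B)=d(A,C)+d(C,B)$. A geodesic space $(K,d)$ satisfies the betweenness property if for every four pairwise distinct points $A,B,C,D\in K$: whenever $B$ lies between $A$ and $C$, and $C$ lies between $B$ and $D$, then both $B$ and $C$ lie between $A$ and $D$. Lion-and-man game: admissible trajectories of each player are the 1-Lipschitz maps $[0,+\infty)\to K$ starting at that player's initial position. The number $\varepsilon>0$ is fixed in advance; Lion wins if $d(L(t),M(t))<\varepsilon$ at some time $t\in[0,+\infty)$. A non-anticipative discrete-time strategy of Lion is given by a step $h>0$ and a map assigning to each initial position $x^0\in K$ of Lion and each admissible trajectory $M$ of Man an admissible trajectory $L=\Lambda(x^0,M)$ of Lion with $L(0)=x^0$,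 such that Lion's motion on each interval $[ih,(i+1)h]$ is decided at time $ih$ from what has been observed so far: for each $i\in\mathbb{N}\cup\{0\}$, if $M$ and $M'$ coincide on $[0,ih]$, then $\Lambda(x^0,M)$ and $\Lambda(x^0,M')$ coincide on $[0,(i+1)h]$. *)

theory Defs
  imports "HOL-Analysis.Analysis"
begin

text \<open>
  A metric space is rendered as a set \<open>K\<close> in a type of class \<^class>\<open>metric_space\<close>, with the
  inherited distance. Functions on an interval of the real line are total functions whose values
  outside that interval are irrelevant.
\<close>

definition geodesic_path ::
    "'a::metric_space set \<Rightarrow> (real \<Rightarrow> 'a) \<Rightarrow> real \<Rightarrow> real \<Rightarrow> 'a \<Rightarrow> 'a \<Rightarrow> bool" where
  "geodesic_path K \<gamma> a b A B \<longleftrightarrow>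
     a \<le> b \<and> \<gamma> \<in> {a..b} \<rightarrow> K \<and> \<gamma> a = A \<and> \<gamma> b = B \<and>
     (\<forall>t\<in>{a..b}. \<forall>t'\<in>{a..b}. dist (\<gamma> t) (\<gamma> t') = \<bar>t - t'\<bar>)"

definition geodesic_space :: "'a::metric_space set \<Rightarrow> bool" where
  "geodesic_space K \<longleftrightarrow> (\<forall>A\<in>K. \<forall>B\<in>K. \<exists>\<gamma> a b. geodesic_path K \<gamma> a b A B)"

definition lies_between :: "'a::metric_space \<Rightarrow> 'a \<Rightarrow> 'a \<Rightarrow> bool" where
  "lies_between C A B \<longleftrightarrow> dist A B = dist A C + dist C B"

definition betweenness_property :: "'a::metric_space set \<Rightarrow> bool" where
  "betweenness_property K \<longleftrightarrow>
     (\<forall>A\<in>K. \<forall>B\<in>K. \<forall>C\<in>K. \<forall>D\<in>K.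
        distinct [A, B, C, D] \<longrightarrow> lies_between B A C \<longrightarrow> lies_between C B D \<longrightarrow>
        lies_between B A D \<and> lies_between C A D)"

definition admissible_trajectories :: "'a::metric_space set \<Rightarrow> 'a \<Rightarrow> (real \<Rightarrow> 'a) set" where
  "admissible_trajectories K x = {f \<in> {0..} \<rightarrow> K. 1-lipschitz_on {0..} f \<and> f 0 = x}"

text \<open>
  In the last clause Man's two trajectories may have different initial positions; for
  \<open>i = 0\<close> the premise says exactly that the initial positions agree. Taken over all \<open>i\<close>, the
  clause also makes \<open>\<Lambda> x M\<close> on \<open>{0..}\<close> depend on \<open>M\<close> only through its values on \<open>{0..}\<close>.
\<close>

definition nonanticipative_strategy ::
    "'a::metric_space set \<Rightarrow> real \<Rightarrow> ('a \<Rightarrow> (real \<Rightarrow> 'a) \<Rightarrow> real \<Rightarrow> 'a) \<Rightarrow> bool" where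
  "nonanticipative_strategy K h \<Lambda> \<longleftrightarrow>
     h > 0 \<and>
     (\<forall>x\<in>K. \<forall>y\<in>K. \<forall>M\<in>admissible_trajectories K y. \<Lambda> x M \<in> admissible_trajectories K x) \<and>
     (\<forall>x\<in>K. \<forall>y\<in>K. \<forall>y'\<in>K.
        \<forall>M\<in>admissible_trajectories K y. \<forall>M'\<in>admissible_trajectories K y'. \<forall>i::nat.
          (\<forall>t\<in>{0..real i * h}. M t = M' t) \<longrightarrow>
          (\<forall>t\<in>{0..real (i + 1) * h}. \<Lambda> x M t = \<Lambda> x M' t))"

end

theory Submission
  imports Defs
begin

text \<open>
  Lion uses simple pursuit: at each time \<open>i * h\<close>, with \<open>h = \<epsilon> / 2\<close>, he looks at Man's position
  \<open>m i\<close> and walks from his own position \<open>l i\<close> at unit speed along a geodesic to \<open>m i\<close> during the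
  next time interval of length \<open>h\<close>. While he is at distance at least \<open>h\<close>, he gains exactly \<open>h\<close> on
  \<open>m i\<close> and Man undoes at most \<open>h\<close> of it, so the distances \<open>dist (l i) (m i)\<close> do not increase.

  Suppose that they stay at least \<open>\<epsilon>\<close>. They converge to some \<open>D \<ge> \<epsilon> > h\<close>, and by compactness the
  game watched from later and later times has a limit, again a pursuit, whose distance is \<open>D\<close>
  at every step (\<open>convergent_shifts\<close>, \<open>discrete_pursuit_captures\<close>). To keep it constant, Man must
  at each step move straight away from Lion: \<open>m i\<close> lies between \<open>l (i + 1)\<close> and \<open>m (i + 1)\<close>, while
  \<open>l (i + 1)\<close> lies between \<open>l i\<close> and \<open>m i\<close>. The betweenness property joins these segments, by
  induction, to \<open>dist (l 0) (m n) = D + n * h\<close> for every \<open>n\<close>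
  (\<open>constant_distance_pursuit_unbounded\<close>), which is impossible in a bounded space.

  The contradiction concerns a single run of the game, so one step \<open>h\<close> serves all of Man's
  trajectories although no common bound on the time of capture is obtained. What remains is to
  assemble the geodesics into 1-Lipschitz trajectories that depend on Man's past only
  (\<open>pursuit_admissible\<close>, \<open>pursuit_nonanticipative\<close>).
\<close>

section \<open>Pursuits with constant distance\<close>

text \<open>
  In the induction step, \<open>l (i + 1)\<close> lies between \<open>l i\<close> and \<open>m (i + n)\<close>, and \<open>m (i + n)\<close> lies
  between \<open>l (i + 1)\<close> and \<open>m (i + n + 1)\<close>, the latter by the induction hypothesis for the pursuit
  from \<open>i + 1\<close> on. The betweenness property then adds \<open>dist (l i) (l (i + 1)) = h\<close> to
  \<open>dist (l (i + 1)) (m (i + n + 1))\<close>. The second equation, an instance of the first for \<open>n > 0\<close> but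
  an assumption for \<open>n = 0\<close>, makes the step uniform in \<open>n\<close>.
\<close>

lemma constant_distance_pursuit_unbounded:
  fixes l m :: "nat \<Rightarrow> 'a::metric_space"
  assumes between: "betweenness_property K"
    and inK: "\<And>i. l i \<in> K" "\<And>i. m i \<in> K"
    and "0 < h" "h < D"
    and const: "\<And>i. dist (l i) (m i) = D"
    and lion_step: "\<And>i. dist (l i) (l (Suc i)) = h"
    and lion_aim: "\<And>i. dist (l (Suc i)) (m i) = D - h"
    and man_step: "\<And>i. dist (m i) (m (Suc i)) = h"
  shows "dist (l i) (m (i + n)) = D + real n * h \<and>
    dist (l (Suc i)) (m (i + n)) = D + real n * h - h"
proof (induction n arbitrary: i)
  case 0
  show ?case by (simp add: const lion_aim)
next
  case (Suc n)
  let ?A = "l i" and ?B = "l (Suc i)" and ?C = "m (i + n)" and ?D = "m (Suc (i + n))"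
  have AC: "dist ?A ?C = D + real n * h" and BC: "dist ?B ?C = D + real n * h - h"
    using Suc.IH[of i] by blast+
  have BD: "dist ?B ?D = D + real n * h" using Suc.IH[of "Suc i"] by simp
  have nh: "0 \<le> real n * h" using \<open>0 < h\<close> by simp
  have "0 < dist ?A ?C" "0 < dist ?B ?C" "0 < dist ?B ?D" "0 < dist ?A ?B" "0 < dist ?C ?D"
    using AC BC BD lion_step[of i] man_step[of "i + n"] \<open>0 < h\<close> \<open>h < D\<close> nh by linarith+
  then have "?A \<noteq> ?C" "?B \<noteq> ?C" "?B \<noteq> ?D" "?A \<noteq> ?B" "?C \<noteq> ?D"
    by simp_all
  \<comment> \<open>\<open>l i\<close> and \<open>m (i + n + 1)\<close> differ since the first is at distance at least \<open>D > h\<close> from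
      \<open>m (i + n)\<close> and the second at distance \<open>h\<close>.\<close>
  moreover have "?A \<noteq> ?D"
    using AC man_step[of "i + n"] \<open>h < D\<close> nh by (auto simp: dist_commute)
  ultimately have "distinct [?A, ?B, ?C, ?D]" by simp
  moreover have "lies_between ?B ?A ?C" "lies_between ?C ?B ?D"
    using AC BC BD lion_step[of i] man_step[of "i + n"] by (simp_all add: lies_between_def)
  ultimately have "lies_between ?B ?A ?D"
    using between inK unfolding betweenness_property_def by blast
  then show ?case
    using BD lion_step[of i] by (simp add: lies_between_def algebra_simps)
qed

section \<open>Limits of shifted sequences\<close>

text \<open>
  The sequences in \<open>C\<close> form a compact set in the product topology by Tychonoff's theorem, and this
  topology is metrizable, so the shifts \<open>\<lambda>n. X (k + n)\<close> have a subsequence that converges in every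
  coordinate at once.
\<close>

lemma convergent_shifts:
  fixes X :: "nat \<Rightarrow> 'a::metric_space"
  assumes "compact C" and "\<And>i. X i \<in> C"
  obtains Y r where "strict_mono (r :: nat \<Rightarrow> nat)" "\<And>n. Y n \<in> C"
    "\<And>n. (\<lambda>k. X (r k + n)) \<longlonglongrightarrow> Y n"
proof -
  have "compactin (product_topology (\<lambda>_::nat. euclidean) UNIV) (PiE UNIV (\<lambda>_. C))"
    unfolding compactin_PiE using assms(1) by simp
  then have "compact (PiE (UNIV :: nat set) (\<lambda>_. C))"
    by (simp add: euclidean_product_topology)
  then have "seq_compact (PiE (UNIV :: nat set) (\<lambda>_. C))"
    by (rule compact_imp_seq_compact)
  moreover have "\<forall>k. (\<lambda>n. X (k + n)) \<in> PiE UNIV (\<lambda>_. C)"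
    using assms(2) by auto
  ultimately obtain Y r where Y: "Y \<in> PiE UNIV (\<lambda>_. C)" "strict_mono (r :: nat \<Rightarrow> nat)"
    "((\<lambda>k n. X (k + n)) \<circ> r) \<longlonglongrightarrow> Y"
    unfolding seq_compact_def by meson
  have "(\<lambda>k. X (r k + n)) \<longlonglongrightarrow> Y n" for n
    using continuous_on_tendsto_compose[OF continuous_on_product_coordinates[of n] Y(3)]
    by (simp add: o_def)
  moreover have "Y n \<in> C" for n using Y(1) by auto
  ultimately show thesis using that Y(2) by blast
qed

section \<open>Discrete pursuit\<close>

text \<open>
  All relations between positions pass to the limit of shifted runs, where in addition the distance
  of the players is constant. The strict inequality \<open>h < \<epsilon>\<close> makes this constant greater than \<open>h\<close>,
  which keeps the points in the betweenness argument distinct.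
\<close>

lemma discrete_pursuit_captures:
  fixes l m :: "nat \<Rightarrow> 'a::metric_space"
  assumes "compact K" and between: "betweenness_property K"
    and inK: "\<And>i. l i \<in> K" "\<And>i. m i \<in> K"
    and "0 < h" "h < \<epsilon>"
    and lion_step: "\<And>i. h \<le> dist (l i) (m i) \<Longrightarrow> dist (l i) (l (Suc i)) = h"
    and lion_aim: "\<And>i. h \<le> dist (l i) (m i) \<Longrightarrow> dist (l (Suc i)) (m i) = dist (l i) (m i) - h"
    and man_step: "\<And>i. dist (m i) (m (Suc i)) \<le> h"
  shows "\<exists>i. dist (l i) (m i) < \<epsilon>"
proof (rule ccontr)
  assume "\<nexists>i. dist (l i) (m i) < \<epsilon>"
  then have far: "\<epsilon> \<le> dist (l i) (m i)" for i by (simp add: not_less)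
  have hle: "h \<le> dist (l i) (m i)" for i using far[of i] \<open>h < \<epsilon>\<close> by linarith
  have "decseq (\<lambda>i. dist (l i) (m i))"
  proof (rule decseq_SucI)
    fix i
    show "dist (l (Suc i)) (m (Suc i)) \<le> dist (l i) (m i)"
      using lion_aim[OF hle, of i] man_step[of i] dist_triangle[of "l (Suc i)" "m (Suc i)" "m i"]
      by linarith
  qed
  then obtain D where D: "(\<lambda>i. dist (l i) (m i)) \<longlonglongrightarrow> D"
    using decseq_convergent[of "\<lambda>i. dist (l i) (m i)" \<epsilon>] far by blast
  have "h < D"
    using LIMSEQ_le_const[OF D, of \<epsilon>] far \<open>h < \<epsilon>\<close> by force
  have "compact (K \<times> K)" using \<open>compact K\<close> by (simp add: compact_Times)
  then obtain Y r where r: "strict_mono (r :: nat \<Rightarrow> nat)" and YK: "\<And>n. Y n \<in> K \<times> K"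
    and Y: "\<And>n. (\<lambda>k. (\<lambda>i. (l i, m i)) (r k + n)) \<longlonglongrightarrow> Y n"
    by (rule convergent_shifts[of "K \<times> K" "\<lambda>i. (l i, m i)"]) (use inK in auto)
  define l' m' where "l' = (\<lambda>n. fst (Y n))" and "m' = (\<lambda>n. snd (Y n))"
  have l': "(\<lambda>k. l (r k + n)) \<longlonglongrightarrow> l' n" and m': "(\<lambda>k. m (r k + n)) \<longlonglongrightarrow> m' n" for n
    using tendsto_fst[OF Y[of n]] tendsto_snd[OF Y[of n]] by (simp_all add: l'_def m'_def)
  have inK': "l' n \<in> K" "m' n \<in> K" for n
    using YK[of n] by (auto simp: l'_def m'_def mem_Times_iff)
  have Dn: "(\<lambda>k. dist (l (r k + n)) (m (r k + n))) \<longlonglongrightarrow> D" for n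
    using LIMSEQ_subseq_LIMSEQ[OF D, of "\<lambda>k. r k + n"] r
    by (simp add: o_def strict_mono_def)
  have const: "dist (l' n) (m' n) = D" for n
    by (rule LIMSEQ_unique[OF tendsto_dist[OF l' m'] Dn])
  have step: "dist (l' n) (l' (Suc n)) = h" for n
    using LIMSEQ_unique[OF tendsto_dist[OF l'[of n] l'[of "Suc n"]], of h] lion_step[OF hle] by simp
  have aim: "dist (l' (Suc n)) (m' n) = D - h" for n
    using LIMSEQ_unique[OF tendsto_dist[OF l'[of "Suc n"] m'[of n]], of "D - h"]
      tendsto_diff[OF Dn[of n] tendsto_const, of h] lion_aim[OF hle] by simp
  have mle: "dist (m' n) (m' (Suc n)) \<le> h" for n
    using LIMSEQ_le_const2[OF tendsto_dist[OF m'[of n] m'[of "Suc n"]], of h] man_step by auto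
  \<comment> \<open>Lion gains \<open>h\<close> in each step, so Man must move by all of \<open>h\<close> to keep the distance.\<close>
  have mstep: "dist (m' n) (m' (Suc n)) = h" for n
    using mle[of n] aim[of n] const[of "Suc n"] dist_triangle[of "l' (Suc n)" "m' (Suc n)" "m' n"]
    by linarith
  have unb: "dist (l' 0) (m' n) = D + real n * h" for n
    using constant_distance_pursuit_unbounded[of K l' m' h D, OF between inK' \<open>0 < h\<close> \<open>h < D\<close> const step aim mstep, of 0 n]
    by simp
  obtain b where b: "\<And>x y. x \<in> K \<Longrightarrow> y \<in> K \<Longrightarrow> dist x y \<le> b"
    using compact_imp_bounded[OF \<open>compact K\<close>] bounded_two_points by metis
  obtain n where "b < real n * h" using ex_less_of_nat_mult[OF \<open>0 < h\<close>] by blast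
  then show False
    using b[OF inK'(1)[of 0] inK'(2)[of n]] unb[of n] \<open>h < D\<close> \<open>0 < h\<close> by linarith
qed

section \<open>Lion's strategy\<close>

text \<open>
  \<open>w A B\<close> walks from \<open>A\<close> straight to \<open>B\<close>. Only the distance to \<open>B\<close> is prescribed: being 1-Lipschitz,
  the walk then is at distance exactly \<open>s\<close> from \<open>A\<close> at time \<open>s \<le> dist A B\<close>.
\<close>

definition unit_speed_walks :: "'a::metric_space set \<Rightarrow> ('a \<Rightarrow> 'a \<Rightarrow> real \<Rightarrow> 'a) \<Rightarrow> bool" where
  "unit_speed_walks K w \<longleftrightarrow>
     (\<forall>A\<in>K. \<forall>B\<in>K. w A B \<in> admissible_trajectories K A \<and>
        (\<forall>s\<in>{0..dist A B}. dist (w A B s) B = dist A B - s))"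

lemma geodesic_space_has_walks:
  fixes K :: "'a::metric_space set"
  assumes "geodesic_space K"
  obtains w where "unit_speed_walks K w"
proof -
  have "\<exists>f. f \<in> admissible_trajectories K A \<and>
        (\<forall>s\<in>{0..dist A B}. dist (f s) B = dist A B - s)" if "A \<in> K" "B \<in> K" for A B
  proof -
    obtain \<gamma> a b where g: "geodesic_path K \<gamma> a b A B"
      using assms \<open>A \<in> K\<close> \<open>B \<in> K\<close> unfolding geodesic_space_def by blast
    then have ab: "a \<le> b" "\<gamma> a = A" "\<gamma> b = B" and gK: "\<And>t. t \<in> {a..b} \<Longrightarrow> \<gamma> t \<in> K"
      and iso: "\<And>t t'. t \<in> {a..b} \<Longrightarrow> t' \<in> {a..b} \<Longrightarrow> dist (\<gamma> t) (\<gamma> t') = \<bar>t - t'\<bar>"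
      unfolding geodesic_path_def by auto
    have AB: "dist A B = b - a" using iso[of a b] ab by simp
    \<comment> \<open>Having reached \<open>B\<close>, the walk stays there.\<close>
    define f where "f = (\<lambda>s. \<gamma> (min (a + s) b))"
    have "f \<in> {0..} \<rightarrow> K" using ab gK by (auto simp: f_def)
    moreover have "1-lipschitz_on {0..} f"
      by (rule lipschitz_onI) (use ab in \<open>auto simp: f_def iso dist_real_def\<close>)
    moreover have "f 0 = A" using ab by (simp add: f_def)
    moreover have "dist (f s) B = dist A B - s" if "s \<in> {0..dist A B}" for s
      using that AB ab iso[of "min (a + s) b" b] by (auto simp: f_def)
    ultimately show ?thesis unfolding admissible_trajectories_def by blast
  qed
  then have "\<forall>A B. \<exists>f. A \<in> K \<longrightarrow> B \<in> K \<longrightarrow> f \<in> admissible_trajectories K A \<and>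
        (\<forall>s\<in>{0..dist A B}. dist (f s) B = dist A B - s)" by blast
  then obtain w where "\<forall>A B. A \<in> K \<longrightarrow> B \<in> K \<longrightarrow> w A B \<in> admissible_trajectories K A \<and>
        (\<forall>s\<in>{0..dist A B}. dist (w A B s) B = dist A B - s)" by metis
  then show thesis using that unfolding unit_speed_walks_def by blast
qed

primrec pursuit_node ::
    "('a \<Rightarrow> 'a \<Rightarrow> real \<Rightarrow> 'a) \<Rightarrow> real \<Rightarrow> 'a \<Rightarrow> (real \<Rightarrow> 'a) \<Rightarrow> nat \<Rightarrow> 'a" where
  "pursuit_node w h x M 0 = x"
| "pursuit_node w h x M (Suc i) = w (pursuit_node w h x M i) (M (real i * h)) h"

definition pursuit ::
    "('a \<Rightarrow> 'a \<Rightarrow> real \<Rightarrow> 'a) \<Rightarrow> real \<Rightarrow> 'a \<Rightarrow> (real \<Rightarrow> 'a) \<Rightarrow> real \<Rightarrow> 'a" where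
  "pursuit w h x M t =
     (let i = nat \<lfloor>t / h\<rfloor> in w (pursuit_node w h x M i) (M (real i * h)) (t - real i * h))"

lemma pursuit_node_in:
  assumes w: "unit_speed_walks K w" and "0 < h" and "x \<in> K"
    and M: "M \<in> admissible_trajectories K y"
  shows "pursuit_node w h x M i \<in> K"
proof (induction i)
  case 0
  show ?case using \<open>x \<in> K\<close> by simp
next
  case (Suc i)
  have "M (real i * h) \<in> K"
    using M \<open>0 < h\<close> unfolding admissible_trajectories_def by (auto simp: Pi_iff)
  then show ?case
    using Suc w \<open>0 < h\<close> unfolding unit_speed_walks_def admissible_trajectories_def
    by (auto simp: Pi_iff)
qed

text \<open>
  The formula holds on the closed step: at its right end the walk of step \<open>i\<close> arrives at the node
  from which the walk of step \<open>i + 1\<close> starts. This gives both the continuity of the pursuit at the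
  nodes and the fact that the position at time \<open>(i + 1) * h\<close> needs no observation after \<open>i * h\<close>.
\<close>

lemma pursuit_on_step:
  assumes w: "unit_speed_walks K w" and "0 < h" and "x \<in> K"
    and M: "M \<in> admissible_trajectories K y"
    and t: "real i * h \<le> t" "t \<le> real (Suc i) * h"
  shows "pursuit w h x M t = w (pursuit_node w h x M i) (M (real i * h)) (t - real i * h)"
proof (cases "t = real (Suc i) * h")
  case True
  have "M (real (Suc i) * h) \<in> K"
    using M \<open>0 < h\<close> unfolding admissible_trajectories_def by (auto simp: Pi_iff)
  then have start: "w (pursuit_node w h x M (Suc i)) (M (real (Suc i) * h)) 0 = pursuit_node w h x M (Suc i)"
    using w pursuit_node_in[OF assms(1-4), of "Suc i"]
    unfolding unit_speed_walks_def admissible_trajectories_def by blast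
  have "nat \<lfloor>t / h\<rfloor> = Suc i"
    using True \<open>0 < h\<close> by (metis floor_of_nat nat_int nonzero_mult_div_cancel_right less_irrefl)
  then have "pursuit w h x M t = pursuit_node w h x M (Suc i)"
    using start True unfolding pursuit_def by (simp del: pursuit_node.simps of_nat_Suc)
  then show ?thesis using True by (simp add: algebra_simps)
next
  case False
  then have "t < real (Suc i) * h" using t by simp
  then have "\<lfloor>t / h\<rfloor> = int i"
    using t \<open>0 < h\<close> by (intro floor_unique) (simp_all add: field_simps)
  then show ?thesis by (simp add: pursuit_def)
qed

lemma pursuit_at_node:
  assumes "unit_speed_walks K w" and "0 < h" and "x \<in> K"
    and M: "M \<in> admissible_trajectories K y"
  shows "pursuit w h x M (real i * h) = pursuit_node w h x M i"
proof -
  have "M (real i * h) \<in> K"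
    using M \<open>0 < h\<close> unfolding admissible_trajectories_def by (auto simp: Pi_iff)
  then show ?thesis
    using pursuit_on_step[OF assms, of i "real i * h"] pursuit_node_in[OF assms, of i] assms(1,2)
    unfolding unit_speed_walks_def admissible_trajectories_def by (simp add: algebra_simps)
qed

lemma step_containing:
  fixes t h :: real
  assumes "0 < h" "0 \<le> t"
  obtains i :: nat where "real i * h \<le> t" "t < real (Suc i) * h"
proof -
  have "real (nat \<lfloor>t / h\<rfloor>) \<le> t / h" "t / h < real (Suc (nat \<lfloor>t / h\<rfloor>))"
    using assms by (simp, simp add: floor_less_iff[symmetric]) linarith
  then show thesis using that[of "nat \<lfloor>t / h\<rfloor>"] \<open>0 < h\<close> by (simp add: field_simps)
qed

lemma pursuit_admissible:
  assumes w: "unit_speed_walks K w" and "0 < h" and "x \<in> K"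
    and M: "M \<in> admissible_trajectories K y"
  shows "pursuit w h x M \<in> admissible_trajectories K x"
proof -
  let ?P = "pursuit w h x M"
  have walk: "w (pursuit_node w h x M i) (M (real i * h)) \<in>
      admissible_trajectories K (pursuit_node w h x M i)" for i
  proof -
    have "M (real i * h) \<in> K"
      using M \<open>0 < h\<close> unfolding admissible_trajectories_def by (auto simp: Pi_iff)
    then show ?thesis
      using w pursuit_node_in[OF assms, of i] unfolding unit_speed_walks_def by blast
  qed
  have "?P t \<in> K" if nonneg: "0 \<le> t" for t
  proof -
    obtain i where i: "real i * h \<le> t" "t < real (Suc i) * h"
      by (rule step_containing[OF \<open>0 < h\<close> nonneg])
    then show ?thesis
      using pursuit_on_step[OF assms, of i t] walk[of i]
      by (auto simp: admissible_trajectories_def Pi_iff)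
  qed
  moreover have step: "1-lipschitz_on {real i * h..real (Suc i) * h} ?P" for i
  proof (rule lipschitz_onI)
    fix s t assume st: "s \<in> {real i * h..real (Suc i) * h}" "t \<in> {real i * h..real (Suc i) * h}"
    have "1-lipschitz_on {0..} (w (pursuit_node w h x M i) (M (real i * h)))"
      using walk[of i] by (simp add: admissible_trajectories_def)
    from lipschitz_onD[OF this, of "s - real i * h" "t - real i * h"]
    show "dist (?P s) (?P t) \<le> 1 * dist s t"
      using st pursuit_on_step[OF assms, of i s] pursuit_on_step[OF assms, of i t]
      by (simp add: dist_real_def)
  qed simp
  have lip: "1-lipschitz_on {0..real i * h} ?P" for i
  proof (induction i)
    case 0
    show ?case by (simp add: lipschitz_on_def)
  next
    case (Suc i)
    then show ?case using lipschitz_on_concat[OF Suc step refl] by simp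
  qed
  have "1-lipschitz_on {0..} ?P"
  proof (rule lipschitz_onI)
    fix s t :: real assume st: "s \<in> {0..}" "t \<in> {0..}"
    have "0 \<le> max s t" using st by auto
    then obtain i where "max s t < real (Suc i) * h"
      by (rule step_containing[OF \<open>0 < h\<close>])
    then show "dist (?P s) (?P t) \<le> 1 * dist s t"
      using lipschitz_onD[OF lip[of "Suc i"], of s t] st by simp
  qed simp
  moreover have "?P 0 = x" using pursuit_at_node[OF assms, of 0] by simp
  ultimately show ?thesis by (auto simp: admissible_trajectories_def)
qed

lemma pursuit_node_cong:
  assumes "\<And>j. j < i \<Longrightarrow> M (real j * h) = M' (real j * h)"
  shows "pursuit_node w h x M i = pursuit_node w h x M' i"
  using assms by (induction i) auto

lemma pursuit_nonanticipative:
  assumes w: "unit_speed_walks K w" and "0 < h"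
  shows "nonanticipative_strategy K h (pursuit w h)"
  unfolding nonanticipative_strategy_def
proof (intro conjI ballI allI impI)
  show "0 < h" by fact
next
  fix x y M assume "x \<in> K" "M \<in> admissible_trajectories K y"
  then show "pursuit w h x M \<in> admissible_trajectories K x"
    using pursuit_admissible[OF w \<open>0 < h\<close>] by blast
next
  fix x y y' M M' t and i :: nat
  assume x: "x \<in> K" and M: "M \<in> admissible_trajectories K y"
    and M': "M' \<in> admissible_trajectories K y'"
    and eq: "\<forall>t\<in>{0..real i * h}. M t = M' t" and t: "t \<in> {0..real (i + 1) * h}"
  have same: "M (real j * h) = M' (real j * h)" if "j \<le> i" for j
    using eq that \<open>0 < h\<close> by simp
  \<comment> \<open>The right end \<open>(i + 1) * h\<close> must be counted to step \<open>i\<close>, whose walk is already fixed.\<close>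
  have "\<exists>j\<le>i. real j * h \<le> t \<and> t \<le> real (Suc j) * h"
  proof (cases "t = real (Suc i) * h")
    case True
    then show ?thesis using \<open>0 < h\<close> by (intro exI[of _ i]) simp
  next
    case False
    obtain j where j: "real j * h \<le> t" "t < real (Suc j) * h"
      using step_containing[OF \<open>0 < h\<close>, of t] t by auto
    then have "real j * h < real (Suc i) * h" using t False by simp
    then have "j \<le> i" using \<open>0 < h\<close> by simp
    then show ?thesis using j by auto
  qed
  then obtain j where "j \<le> i" and j: "real j * h \<le> t" "t \<le> real (Suc j) * h" by blast
  then show "pursuit w h x M t = pursuit w h x M' t"
    using pursuit_on_step[OF w \<open>0 < h\<close> x M j] pursuit_on_step[OF w \<open>0 < h\<close> x M' j]
      same[of j] pursuit_node_cong[of j M h M' w x] same by simp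
qed

theorem theorem1:
  fixes K :: "'a::metric_space set"
  assumes "compact K"
    and "geodesic_space K"
    and "betweenness_property K"
  shows "\<forall>\<epsilon>>0. \<exists>h \<Lambda>. nonanticipative_strategy K h \<Lambda> \<and>
    (\<forall>x\<^sub>0\<in>K. \<forall>y\<^sub>0\<in>K. \<forall>M\<in>admissible_trajectories K y\<^sub>0.
      \<exists>t\<ge>0. dist (\<Lambda> x\<^sub>0 M t) (M t) < \<epsilon>)"
proof (intro allI impI)
  fix \<epsilon> :: real assume "0 < \<epsilon>"
  obtain w where w: "unit_speed_walks K w"
    using geodesic_space_has_walks[OF assms(2)] .
  define h where "h = \<epsilon> / 2"
  have h: "0 < h" "h < \<epsilon>" using \<open>0 < \<epsilon>\<close> by (simp_all add: h_def)
  have "\<exists>t\<ge>0. dist (pursuit w h x M t) (M t) < \<epsilon>"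
    if x: "x \<in> K" and M: "M \<in> admissible_trajectories K y" for x y M
  proof -
    define l m where "l = pursuit_node w h x M" and "m = (\<lambda>i. M (real i * h))"
    have lK: "l i \<in> K" for i
      unfolding l_def by (rule pursuit_node_in[OF w h(1) x M])
    have mK: "m i \<in> K" for i
      using M h unfolding m_def admissible_trajectories_def by (auto simp: Pi_iff)
    have walk: "w (l i) (m i) \<in> admissible_trajectories K (l i)"
      "s \<in> {0..dist (l i) (m i)} \<Longrightarrow> dist (w (l i) (m i) s) (m i) = dist (l i) (m i) - s" for i s
      using w lK mK unfolding unit_speed_walks_def by blast+
    have l_Suc: "l (Suc i) = w (l i) (m i) h" for i by (simp add: l_def m_def)
    have aim: "dist (l (Suc i)) (m i) = dist (l i) (m i) - h" if "h \<le> dist (l i) (m i)" for i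
      using walk(2)[of h i] that h by (simp add: l_Suc)
    have step: "dist (l i) (l (Suc i)) = h" if "h \<le> dist (l i) (m i)" for i
    proof (rule antisym)
      have "1-lipschitz_on {0..} (w (l i) (m i))" "w (l i) (m i) 0 = l i"
        using walk(1)[of i] by (simp_all add: admissible_trajectories_def)
      then show "dist (l i) (l (Suc i)) \<le> h"
        using lipschitz_onD[of 1 "{0..}" "w (l i) (m i)" 0 h] h by (simp add: l_Suc)
      show "h \<le> dist (l i) (l (Suc i))"
        using aim[OF that] dist_triangle[of "l i" "m i" "l (Suc i)"] by linarith
    qed
    have man: "dist (m i) (m (Suc i)) \<le> h" for i
    proof -
      have "1-lipschitz_on {0..} M" using M by (simp add: admissible_trajectories_def)
      from lipschitz_onD[OF this, of "real i * h" "real (Suc i) * h"] show ?thesis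
        using h by (simp add: m_def dist_real_def algebra_simps)
    qed
    obtain i where "dist (l i) (m i) < \<epsilon>"
      using discrete_pursuit_captures[of K l m h \<epsilon>, OF assms(1,3) lK mK h step aim man] by blast
    then have "dist (pursuit w h x M (real i * h)) (M (real i * h)) < \<epsilon>"
      using pursuit_at_node[OF w h(1) x M, of i] by (simp add: l_def m_def)
    then show ?thesis using h by (intro exI[of _ "real i * h"]) simp
  qed
  then show "\<exists>h \<Lambda>. nonanticipative_strategy K h \<Lambda> \<and>
    (\<forall>x\<^sub>0\<in>K. \<forall>y\<^sub>0\<in>K. \<forall>M\<in>admissible_trajectories K y\<^sub>0.
      \<exists>t\<ge>0. dist (\<Lambda> x\<^sub>0 M t) (M t) < \<epsilon>)"
    using pursuit_nonanticipative[OF w h(1)] by blast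
qed

end
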